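(* Let $(X,d)$ be a complete dislocated metric space and let $T:X\to X$ be an $\mathcal{A}_d$-contraction. Then $T$ has a unique fixed point $z\in X$. Moreover, $d(z,z)=0$.
   Context: Write $\mathbb{R}_+=[0,\infty)$. A dislocated metric on a non-empty set $X$ is a function $d:X\times X\to\mathbb{R}_+$ such that for all $x,y,z\in X$: (i) $d(x,y)=d(y,x)$; (ii) $d(x,y)=0$ implies $x=y$; (iii) $d(x,y)\le d(x,z)+d(z,y)$. (The self-distance $d(x,x)$ is not required to be zero.) Then $(X,d)$ is called a dislocated metric space. A sequence $\{x_n\}$ in $X$ is $d$-Cauchy if for every $\varepsilon>0$ there is $n_0\in\mathbb{N}$ with $d(x_m,x_n)<\varepsilon$ for all $m,n\ge n_0$ (including $m=n$). A sequence $\{x_n\}$ converges to $x\in X$ with respect to $d$ if $\lim_{n\to\infty}d(x_n,x)=0$. $(X,d)$ is complete if every $d$-Cauchy sequence converges with respect to $d$ to some point of $X$. The class $\mathcal{A}_d$ consists of all functions $\alpha:\mathbb{R}_+^3\to\mathbb{R}_+$ such that: (A1) $\alpha$ is continuous on $\mathbb{R}_+^3$; (A2) there exists a constant $k_\alpha\in[0,1)$ such that, for all $a,b\in\mathbb{R}_+$, whenever $a\le\alpha(a,b,b)$ or $a\le\alpha(b,a,b)$ or $a\le\alpha(b,b,a)$, then $a\le k_\alpha b$. A self-mapping $T$ on a dislocated metric space $(X,d)$ is an $\mathcal{A}_d$-contraction if there exists $\alpha\in\mathcal{A}_d$ such that $d(Tx,Ty)\le\alpha\bigl(d(x,y),d(x,Tx),d(y,Ty)\bigr)$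 for all $x,y\in X$. *)

theory Defs
  imports Complex_Main
begin

definition dislocated_metric_space :: "'a set \<Rightarrow> ('a \<Rightarrow> 'a \<Rightarrow> real) \<Rightarrow> bool" where
  "dislocated_metric_space X d \<longleftrightarrow>
     X \<noteq> {} \<and>
     (\<forall>x\<in>X. \<forall>y\<in>X. 0 \<le> d x y) \<and>
     (\<forall>x\<in>X. \<forall>y\<in>X. d x y = d y x) \<and>
     (\<forall>x\<in>X. \<forall>y\<in>X. d x y = 0 \<longrightarrow> x = y) \<and>
     (\<forall>x\<in>X. \<forall>y\<in>X. \<forall>z\<in>X. d x y \<le> d x z + d z y)"

text \<open>
  Self-distances need not vanish, so the case \<open>m = n\<close> of the Cauchy condition is a genuine
  requirement, and the \<open>d\<close>-limit of a sequence has self-distance zero.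
\<close>

definition dislocated_Cauchy :: "('a \<Rightarrow> 'a \<Rightarrow> real) \<Rightarrow> (nat \<Rightarrow> 'a) \<Rightarrow> bool" where
  "dislocated_Cauchy d x \<longleftrightarrow> (\<forall>\<epsilon>>0. \<exists>n0. \<forall>m\<ge>n0. \<forall>n\<ge>n0. d (x m) (x n) < \<epsilon>)"

definition dislocated_converges :: "('a \<Rightarrow> 'a \<Rightarrow> real) \<Rightarrow> (nat \<Rightarrow> 'a) \<Rightarrow> 'a \<Rightarrow> bool" where
  "dislocated_converges d x l \<longleftrightarrow> (\<lambda>n. d (x n) l) \<longlonglongrightarrow> 0"

definition complete_dislocated_metric_space :: "'a set \<Rightarrow> ('a \<Rightarrow> 'a \<Rightarrow> real) \<Rightarrow> bool" where
  "complete_dislocated_metric_space X d \<longleftrightarrow>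
     dislocated_metric_space X d \<and>
     (\<forall>x. range x \<subseteq> X \<longrightarrow> dislocated_Cauchy d x \<longrightarrow> (\<exists>l\<in>X. dislocated_converges d x l))"

text \<open>Only the values of \<open>\<alpha>\<close> on the closed nonnegative octant matter.\<close>

definition class_A_d :: "(real \<times> real \<times> real \<Rightarrow> real) set" where
  "class_A_d = {\<alpha>.
     (\<forall>a\<ge>0. \<forall>b\<ge>0. \<forall>c\<ge>0. 0 \<le> \<alpha> (a, b, c)) \<and>
     continuous_on ({0..} \<times> {0..} \<times> {0..}) \<alpha> \<and>
     (\<exists>k. 0 \<le> k \<and> k < 1 \<and>
        (\<forall>a\<ge>0. \<forall>b\<ge>0.
           a \<le> \<alpha> (a, b, b) \<or> a \<le> \<alpha> (b, a, b) \<or> a \<le> \<alpha> (b, b, a) \<longrightarrow> a \<le> k * b))}"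

definition A_d_contraction :: "'a set \<Rightarrow> ('a \<Rightarrow> 'a \<Rightarrow> real) \<Rightarrow> ('a \<Rightarrow> 'a) \<Rightarrow> bool" where
  "A_d_contraction X d T \<longleftrightarrow>
     (\<exists>\<alpha>\<in>class_A_d. \<forall>x\<in>X. \<forall>y\<in>X. d (T x) (T y) \<le> \<alpha> (d x y, d x (T x), d y (T y)))"

end

theory Submission
  imports Defs
begin

text \<open>
  The third alternative of (A2) makes successive distances along a Picard orbit decay geometrically,
  so the orbit is Cauchy and has a limit \<open>z\<close>; every limit has self-distance zero. Passing to the
  limit in the contraction inequality gives \<open>d z (T z) \<le> \<alpha> (0, 0, d z (T z))\<close>, which (A2) with
  \<open>b = 0\<close> turns into \<open>d z (T z) = 0\<close>. For a fixed point \<open>w\<close>, (A2) yields first \<open>d w w = 0\<close>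
  and then \<open>d z w \<le> \<alpha> (d z w, 0, 0)\<close>, hence \<open>d z w = 0\<close>.
\<close>

lemma dislocated_metric_spaceD:
  assumes "dislocated_metric_space X d" "x \<in> X" "y \<in> X"
  shows dislocated_nonneg: "0 \<le> d x y"
    and dislocated_commute: "d x y = d y x"
    and dislocated_eqI: "d x y = 0 \<Longrightarrow> x = y"
    and dislocated_triangle: "z \<in> X \<Longrightarrow> d x y \<le> d x z + d z y"
  using assms unfolding dislocated_metric_space_def by blast+

text \<open>Going from \<open>l\<close> to \<open>x n\<close> and back bounds \<open>d l l\<close>
  by twice \<open>d (x n) l\<close>, which tends to 0.\<close>

lemma dislocated_limit_self_distance:
  assumes "dislocated_metric_space X d" "range x \<subseteq> X" "l \<in> X" "dislocated_converges d x l"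
  shows "d l l = 0"
proof -
  have "d l l \<le> d (x n) l + d (x n) l" for n
    using assms dislocated_triangle[of X d l l "x n"] dislocated_commute[of X d l "x n"]
    by (auto simp: subset_iff)
  moreover have "(\<lambda>n. d (x n) l + d (x n) l) \<longlonglongrightarrow> 0 + 0"
    using assms(4) unfolding dislocated_converges_def by (intro tendsto_add)
  ultimately have "d l l \<le> 0 + 0"
    using LIMSEQ_le_const by blast
  then show ?thesis
    using dislocated_nonneg[OF assms(1,3,3)] by linarith
qed

text \<open>The factor 2 accounts for \<open>p = 0\<close>, where the self-distance need not vanish.\<close>

lemma dislocated_geometric_bound:
  fixes k :: real
  assumes M: "dislocated_metric_space X d" and x: "range x \<subseteq> X"
    and k: "0 \<le> k" "k < 1"
    and step: "\<And>n. d (x (Suc n)) (x (Suc (Suc n))) \<le> k * d (x n) (x (Suc n))"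
  shows "(1 - k) * d (x n) (x (n + p)) \<le> 2 * (k ^ n * d (x 0) (x 1))"
proof -
  have xX: "x n \<in> X" for n
    using x by auto
  define D where "D = d (x 0) (x 1)"
  have D: "0 \<le> D"
    unfolding D_def using dislocated_nonneg[OF M xX xX] .
  have pow: "d (x n) (x (Suc n)) \<le> k ^ n * D" for n
  proof (induction n)
    case (Suc n)
    show ?case
      using step[of n] mult_left_mono[OF Suc k(1)] by (simp add: mult.assoc)
  qed (simp add: D_def)
  \<comment> \<open>Induction on the gap \<open>p\<close> splits off the first link, so the
    hypothesis is needed at \<open>Suc n\<close> and \<open>n\<close> must stay general.\<close>
  have "(1 - k) * d (x n) (x (n + p)) \<le> 2 * (k ^ n * D)" for n
  proof (induction p arbitrary: n)
    case 0
    \<comment> \<open>A self-distance is bounded by the detour to the next point and back.\<close>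
    have "d (x n) (x n) \<le> 2 * (k ^ n * D)"
      using dislocated_triangle[OF M xX[of n] xX[of n] xX[of "Suc n"]]
        dislocated_commute[OF M xX[of n] xX[of "Suc n"]] pow[of n] by linarith
    moreover have "(1 - k) * d (x n) (x n) \<le> 1 * d (x n) (x n)"
      using k dislocated_nonneg[OF M xX xX] by (intro mult_right_mono) auto
    ultimately show ?case
      by simp
  next
    case (Suc p)
    have "(1 - k) * d (x n) (x (n + Suc p))
        \<le> (1 - k) * (d (x n) (x (Suc n)) + d (x (Suc n)) (x (Suc n + p)))"
      using k dislocated_triangle[OF M xX[of n] xX[of "n + Suc p"] xX[of "Suc n"]]
      by (intro mult_left_mono) auto
    \<comment> \<open>The coefficients add up to (1 - k) + 2k = 1 + k \<le> 2, so the factor 2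
      reproduces itself.\<close>
    also have "\<dots> \<le> (1 - k) * (k ^ n * D) + 2 * (k ^ Suc n * D)"
      unfolding distrib_left
      using k by (intro add_mono mult_left_mono pow Suc.IH) simp
    also have "\<dots> = (1 + k) * (k ^ n * D)"
      by (simp add: algebra_simps)
    also have "\<dots> \<le> 2 * (k ^ n * D)"
      using k D by (intro mult_right_mono) auto
    finally show ?case .
  qed
  then show ?thesis
    by (simp add: D_def)
qed

text \<open>The geometric bound does not depend on the gap and tends to 0. Gap 0 is included, which
  settles the self-distances that the Cauchy condition also constrains.\<close>

lemma dislocated_Cauchy_geometric:
  fixes k :: real
  assumes M: "dislocated_metric_space X d" and x: "range x \<subseteq> X"
    and k: "0 \<le> k" "k < 1"
    and step: "\<And>n. d (x (Suc n)) (x (Suc (Suc n))) \<le> k * d (x n) (x (Suc n))"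
  shows "dislocated_Cauchy d x"
  unfolding dislocated_Cauchy_def
proof (intro allI impI)
  fix e :: real
  assume e: "e > 0"
  have lim: "(\<lambda>n. 2 * (k ^ n * d (x 0) (x 1))) \<longlonglongrightarrow> 2 * (0 * d (x 0) (x 1))"
    using k by (intro tendsto_intros LIMSEQ_power_zero) auto
  have "\<forall>\<^sub>F n in sequentially. 2 * (k ^ n * d (x 0) (x 1)) < (1 - k) * e"
    using e k by (intro order_tendstoD(2)[OF lim]) simp
  then obtain N where N: "\<And>n. n \<ge> N \<Longrightarrow> 2 * (k ^ n * d (x 0) (x 1)) < (1 - k) * e"
    unfolding eventually_sequentially by blast
  have less: "d (x m) (x n) < e" if "N \<le> m" "m \<le> n" for m n
  proof -
    have "(1 - k) * d (x m) (x n) < (1 - k) * e"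
      using dislocated_geometric_bound[OF M x k, OF step, of m "n - m"] N[OF that(1)] that(2) by simp
    then show ?thesis
      using k by simp
  qed
  have "d (x m) (x n) < e" if "N \<le> m" "N \<le> n" for m n
    using less[of m n] less[of n m] that dislocated_commute[OF M, of "x m" "x n"] x
    by (cases "m \<le> n") (auto simp: subset_iff)
  then show "\<exists>n0. \<forall>m\<ge>n0. \<forall>n\<ge>n0. d (x m) (x n) < e"
    by blast
qed

theorem theorem3p6:
  fixes X :: "'a set" and d :: "'a \<Rightarrow> 'a \<Rightarrow> real" and T :: "'a \<Rightarrow> 'a"
  assumes "complete_dislocated_metric_space X d"
    and "T ` X \<subseteq> X"
    and "A_d_contraction X d T"
  shows "\<exists>z\<in>X. T z = z \<and> (\<forall>w\<in>X. T w = w \<longrightarrow> w = z) \<and> d z z = 0"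
proof -
  have M: "dislocated_metric_space X d"
    using assms(1) unfolding complete_dislocated_metric_space_def by blast
  have TX: "T y \<in> X" if "y \<in> X" for y
    using that assms(2) by blast
  obtain \<alpha> where \<alpha>: "\<alpha> \<in> class_A_d"
    and contr: "\<And>y z. y \<in> X \<Longrightarrow> z \<in> X \<Longrightarrow> d (T y) (T z) \<le> \<alpha> (d y z, d y (T y), d z (T z))"
    using assms(3) unfolding A_d_contraction_def by (elim bexE) simp
  from \<alpha> obtain k where cont: "continuous_on ({0..} \<times> {0..} \<times> {0..}) \<alpha>"
    and k: "0 \<le> k" "k < 1"
    and A2: "\<And>a b. 0 \<le> a \<Longrightarrow> 0 \<le> b \<Longrightarrow>
      a \<le> \<alpha> (a, b, b) \<or> a \<le> \<alpha> (b, a, b) \<or> a \<le> \<alpha> (b, b, a) \<Longrightarrow> a \<le> k * b"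
    unfolding class_A_d_def mem_Collect_eq by (elim conjE exE) metis
  obtain x0 where x0: "x0 \<in> X"
    using M unfolding dislocated_metric_space_def by blast
  define x where "x n = (T ^^ n) x0" for n
  have x_Suc: "x (Suc n) = T (x n)" for n
    by (simp add: x_def)
  have xX: "x n \<in> X" for n
    by (induction n) (simp_all add: x_def x0 TX)
  then have xr: "range x \<subseteq> X"
    by blast
  \<comment> \<open>With \<open>a\<close> the new distance and \<open>b\<close> the old one, the
    contraction at \<open>x n\<close>, \<open>x (Suc n)\<close> reads a \<le>
    \<open>\<alpha> (b, b, a)\<close>.\<close>
  have step: "d (x (Suc n)) (x (Suc (Suc n))) \<le> k * d (x n) (x (Suc n))" for n
    using contr[OF xX[of n] xX[of "Suc n"]] dislocated_nonneg[OF M xX xX]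
    by (intro A2) (simp_all flip: x_Suc)
  obtain z where z: "z \<in> X" and lim: "dislocated_converges d x z"
    using assms(1) xr dislocated_Cauchy_geometric[OF M xr k, OF step]
    unfolding complete_dislocated_metric_space_def by blast
  have zz: "d z z = 0"
    using dislocated_limit_self_distance[OF M xr z lim] .
  have xz: "(\<lambda>n. d (x n) z) \<longlonglongrightarrow> 0"
    using lim unfolding dislocated_converges_def .
  have xz': "(\<lambda>n. d (x (Suc n)) z) \<longlonglongrightarrow> 0"
    using LIMSEQ_Suc[OF xz] .
  have xx: "(\<lambda>n. d (x n) (x (Suc n))) \<longlonglongrightarrow> 0"
  proof (rule tendsto_sandwich[OF _ _ tendsto_const])
    show "(\<lambda>n. d (x n) z + d (x (Suc n)) z) \<longlonglongrightarrow> 0"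
      using tendsto_add[OF xz xz'] by simp
    show "\<forall>\<^sub>F n in sequentially. d (x n) (x (Suc n)) \<le> d (x n) z + d (x (Suc n)) z"
      using dislocated_triangle[OF M xX xX z] dislocated_commute[OF M z xX] by simp
    show "\<forall>\<^sub>F n in sequentially. 0 \<le> d (x n) (x (Suc n))"
      using dislocated_nonneg[OF M xX xX] by simp
  qed
  define a where "a = d z (T z)"
  have a: "0 \<le> a"
    unfolding a_def using dislocated_nonneg[OF M z TX[OF z]] .
  \<comment> \<open>The third argument is frozen at \<open>a\<close>; the triples stay in the closed
    octant, where \<open>\<alpha>\<close> is continuous.\<close>
  have "(\<lambda>n. \<alpha> (d (x n) z, d (x n) (x (Suc n)), a)) \<longlonglongrightarrow> \<alpha> (0, 0, a)"
  proof (rule continuous_on_tendsto_compose[OF cont])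
    show "(\<lambda>n. (d (x n) z, d (x n) (x (Suc n)), a)) \<longlonglongrightarrow> (0, 0, a)"
      by (intro tendsto_Pair xz xx tendsto_const)
  qed (use a dislocated_nonneg[OF M xX] xX z in auto)
  with xz' have "(\<lambda>n. d (x (Suc n)) z + \<alpha> (d (x n) z, d (x n) (x (Suc n)), a)) \<longlonglongrightarrow> 0 + \<alpha> (0, 0, a)"
    by (rule tendsto_add)
  \<comment> \<open>Triangle inequality through \<open>x (Suc n)\<close> = \<open>T (x n)\<close>,
    then the contraction at \<open>x n\<close>, \<open>z\<close>.\<close>
  moreover have "a \<le> d (x (Suc n)) z + \<alpha> (d (x n) z, d (x n) (x (Suc n)), a)" for n
    using dislocated_triangle[OF M z TX[OF z] xX[of "Suc n"]]
      dislocated_commute[OF M z xX[of "Suc n"]] contr[OF xX[of n] z]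
    by (simp add: a_def x_Suc)
  ultimately have "a \<le> 0 + \<alpha> (0, 0, a)"
    using LIMSEQ_le_const by blast
  then have "a = 0"
    using A2[of a 0] a by simp
  then have Tz: "T z = z"
    using dislocated_eqI[OF M z TX[OF z]] by (simp add: a_def)
  have "w = z" if w: "w \<in> X" and Tw: "T w = w" for w
  proof -
    \<comment> \<open>All three arguments of \<open>\<alpha>\<close> equal \<open>d w w\<close>, so
      (A2) applies with a = b.\<close>
    have "d w w \<le> k * d w w"
      using contr[OF w w] dislocated_nonneg[OF M w w] by (intro A2) (auto simp: Tw)
    then have "(1 - k) * d w w \<le> 0"
      by (simp add: algebra_simps)
    then have "d w w = 0"
      using k dislocated_nonneg[OF M w w] by (simp add: mult_le_0_iff)
    \<comment> \<open>Both self-distances vanish, so this is the first alternative of (A2) with b =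
      0.\<close>
    then have "d w z \<le> k * 0"
      using contr[OF w z] dislocated_nonneg[OF M w z] by (intro A2) (auto simp: Tw Tz zz)
    then show ?thesis
      using dislocated_eqI[OF M w z] dislocated_nonneg[OF M w z] by simp
  qed
  with z Tz zz show ?thesis
    by blast
qed

end
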